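(* Let $\gamma:\mathbb{S}^1\to\mathbb{R}^+$ be an anisotropic surface energy with Cahn-Hoffman vector $\boldsymbol{\xi}$, and let $k:\mathbb{S}^1\to\mathbb{R}^+$ be any function. With the symmetric surface energy matrix $$\boldsymbol{Z}_k(\boldsymbol{n})=\gamma(\boldsymbol{n})I_2-\boldsymbol{n}\boldsymbol{\xi}(\boldsymbol{n})^T-\boldsymbol{\xi}(\boldsymbol{n})\boldsymbol{n}^T+k(\boldsymbol{n})\boldsymbol{n}\boldsymbol{n}^T,\qquad\boldsymbol{n}\in\mathbb{S}^1,$$ the anisotropic surface diffusion system for an evolving closed curve $\boldsymbol{X}(s,t)$ and its chemical potential $\mu(s,t)$, $$\boldsymbol{n}\cdot\partial_t\boldsymbol{X}=\partial_{ss}\mu,\qquad \mu\,\boldsymbol{n}=-\partial_s\boldsymbol{\xi}^\perp,\qquad\boldsymbol{\xi}=\boldsymbol{\xi}(\boldsymbol{n}),$$ can be reformulated equivalently as $$\boldsymbol{n}\cdot\partial_t\boldsymbol{X}=\partial_{ss}\mu,\qquad \mu\,\boldsymbol{n}=-\partial_s\bigl(\boldsymbol{Z}_k(\boldsymbol{n})\,\partial_s\boldsymbol{X}\bigr).$$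
   Context: $\mathbb{S}^1\subset\mathbb{R}^2$ is the unit circle, $\mathbb{R}^+=(0,\infty)$, and $^\perp$ denotes clockwise rotation by $\pi/2$, i.e. $(a,b)^\perp=(b,-a)$. A function $\gamma:\mathbb{S}^1\to\mathbb{R}^+$ is extended to $\mathbb{R}^2$ by $\gamma(\boldsymbol{p})=|\boldsymbol{p}|\gamma(\boldsymbol{p}/|\boldsymbol{p}|)$ for $\boldsymbol{p}\ne\boldsymbol{0}$, $\gamma(\boldsymbol{0})=0$ (assumed sufficiently smooth away from $\boldsymbol{0}$ for the expressions to make sense), and $\boldsymbol{\xi}(\boldsymbol{n})=\nabla\gamma(\boldsymbol{p})|_{\boldsymbol{p}=\boldsymbol{n}}$. The closed curve $\Gamma(t)$ is parametrized by $\boldsymbol{X}(s,t)\in\mathbb{R}^2$, with $s$ its arclength parameter and $t$ time; its unit tangent is $\boldsymbol{\tau}=\partial_s\boldsymbol{X}=\boldsymbol{n}^\perp$ and its outward unit normal is $\boldsymbol{n}=-\partial_s\boldsymbol{X}^\perp=-\boldsymbol{\tau}^\perp$. *)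

theory Defs
  imports "HOL-Analysis.Analysis"
begin

text \<open>Rotation by $\pi/2$, clockwise.\<close>

definition perp :: "real^2 \<Rightarrow> real^2" where
  "perp p = vector [p $ 2, - p $ 1]"

text \<open>Functions on the unit circle are total functions on the plane of which only the values on
  \<^term>\<open>sphere 0 1\<close> are ever used.\<close>

definition hom_ext :: "(real^2 \<Rightarrow> real) \<Rightarrow> real^2 \<Rightarrow> real" where
  "hom_ext \<gamma> p = (if p = 0 then 0 else norm p * \<gamma> (p /\<^sub>R norm p))"

definition surface_energy :: "(real^2 \<Rightarrow> real) \<Rightarrow> bool" where
  "surface_energy \<gamma> \<longleftrightarrow>
     (\<forall>n\<in>sphere 0 1. \<gamma> n > 0) \<and> (\<forall>p. p \<noteq> 0 \<longrightarrow> hom_ext \<gamma> differentiable at p)"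

definition cahn_hoffman :: "(real^2 \<Rightarrow> real) \<Rightarrow> real^2 \<Rightarrow> real^2" where
  "cahn_hoffman \<gamma> n = (THE \<xi>. GDERIV (hom_ext \<gamma>) n :> \<xi>)"

definition outer_prod :: "real^2 \<Rightarrow> real^2 \<Rightarrow> real^2^2" where
  "outer_prod u v = (columnvector u :: real^1^2) ** transpose (columnvector v :: real^1^2)"

definition Z_matrix :: "(real^2 \<Rightarrow> real) \<Rightarrow> (real^2 \<Rightarrow> real) \<Rightarrow> real^2 \<Rightarrow> real^2^2" where
  "Z_matrix \<gamma> k n =
     \<gamma> n *\<^sub>R mat 1 - outer_prod n (cahn_hoffman \<gamma> n) - outer_prod (cahn_hoffman \<gamma> n) n
     + k n *\<^sub>R outer_prod n n"

text \<open>Functions of \<open>(s, t)\<close> are curried. The time derivative is taken within the time interval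
  \<open>I\<close>, hence one-sided at an end point belonging to \<open>I\<close>. These operators are meaningful only
  where the function is differentiable, which is always required separately.\<close>

definition ds :: "(real \<Rightarrow> real \<Rightarrow> 'a::real_normed_vector) \<Rightarrow> real \<Rightarrow> real \<Rightarrow> 'a" where
  "ds f s t = vector_derivative (\<lambda>\<sigma>. f \<sigma> t) (at s)"

definition dt :: "real set \<Rightarrow> (real \<Rightarrow> real \<Rightarrow> 'a::real_normed_vector) \<Rightarrow> real \<Rightarrow> real \<Rightarrow> 'a" where
  "dt I f s t = vector_derivative (\<lambda>\<theta>. f s \<theta>) (at t within I)"

definition ds_exists :: "(real \<Rightarrow> real \<Rightarrow> 'a::real_normed_vector) \<Rightarrow> real \<Rightarrow> real \<Rightarrow> bool" where
  "ds_exists f s t \<longleftrightarrow> (\<lambda>\<sigma>. f \<sigma> t) differentiable at s"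

definition dt_exists ::
    "real set \<Rightarrow> (real \<Rightarrow> real \<Rightarrow> 'a::real_normed_vector) \<Rightarrow> real \<Rightarrow> real \<Rightarrow> bool" where
  "dt_exists I f s t \<longleftrightarrow> (\<lambda>\<theta>. f s \<theta>) differentiable at t within I"

definition normal :: "(real \<Rightarrow> real \<Rightarrow> real^2) \<Rightarrow> real \<Rightarrow> real \<Rightarrow> real^2" where
  "normal X s t = - perp (ds X s t)"

text \<open>At time \<open>t\<close> the curve has length \<open>L t\<close>, and \<open>X\<close> is the \<open>L t\<close>-periodic extension of its
  arclength parametrization. The last clause fixes the orientation: \<open>normal X s t\<close> points out of
  the curve, into the unbounded component of its complement (so simple curves run clockwise).\<close>

definition evolving_closed_curve ::
    "real set \<Rightarrow> (real \<Rightarrow> real) \<Rightarrow> (real \<Rightarrow> real \<Rightarrow> real^2) \<Rightarrow> bool" where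
  "evolving_closed_curve I L X \<longleftrightarrow>
     (\<forall>t\<in>I. L t > 0 \<and>
       (\<forall>s. X (s + L t) t = X s t
          \<and> ds_exists X s t \<and> norm (ds X s t) = 1
          \<and> dt_exists I X s t
          \<and> (\<forall>\<^sub>F \<delta> in at_right 0. X s t + \<delta> *\<^sub>R normal X s t \<in> outside (range (\<lambda>\<sigma>. X \<sigma> t)))))"

text \<open>Solutions are classical: each equation includes the existence of the derivatives in it.\<close>

definition normal_velocity_eq ::
    "real set \<Rightarrow> (real \<Rightarrow> real \<Rightarrow> real^2) \<Rightarrow> (real \<Rightarrow> real \<Rightarrow> real) \<Rightarrow> real \<Rightarrow> real \<Rightarrow> bool" where
  "normal_velocity_eq I X \<mu> s t \<longleftrightarrow>
     dt_exists I X s t \<and> ds_exists \<mu> s t \<and> ds_exists (ds \<mu>) s t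
     \<and> normal X s t \<bullet> dt I X s t = ds (ds \<mu>) s t"

definition asd_system ::
    "(real^2 \<Rightarrow> real) \<Rightarrow> real set \<Rightarrow> (real \<Rightarrow> real \<Rightarrow> real^2) \<Rightarrow> (real \<Rightarrow> real \<Rightarrow> real) \<Rightarrow> bool" where
  "asd_system \<gamma> I X \<mu> \<longleftrightarrow>
     (\<forall>t\<in>I. \<forall>s. normal_velocity_eq I X \<mu> s t
        \<and> ds_exists (\<lambda>\<sigma> \<theta>. cahn_hoffman \<gamma> (normal X \<sigma> \<theta>)) s t
        \<and> \<mu> s t *\<^sub>R normal X s t = - perp (ds (\<lambda>\<sigma> \<theta>. cahn_hoffman \<gamma> (normal X \<sigma> \<theta>)) s t))"

definition asd_system_Z ::
    "(real^2 \<Rightarrow> real) \<Rightarrow> (real^2 \<Rightarrow> real) \<Rightarrow> real set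
      \<Rightarrow> (real \<Rightarrow> real \<Rightarrow> real^2) \<Rightarrow> (real \<Rightarrow> real \<Rightarrow> real) \<Rightarrow> bool" where
  "asd_system_Z \<gamma> k I X \<mu> \<longleftrightarrow>
     (\<forall>t\<in>I. \<forall>s. normal_velocity_eq I X \<mu> s t
        \<and> ds_exists (\<lambda>\<sigma> \<theta>. Z_matrix \<gamma> k (normal X \<sigma> \<theta>) *v ds X \<sigma> \<theta>) s t
        \<and> \<mu> s t *\<^sub>R normal X s t = - ds (\<lambda>\<sigma> \<theta>. Z_matrix \<gamma> k (normal X \<sigma> \<theta>) *v ds X \<sigma> \<theta>) s t)"

end

theory Submission
  imports Defs
begin

text \<open>Euler's identity for the 1-homogeneous extension gives \<open>\<xi>(n) \<bullet> n = \<gamma>(n)\<close>. Expanding \<open>\<xi>(n)\<close>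
  in the orthonormal basis \<open>n, \<tau>\<close> and rotating it then gives \<open>\<xi>\<^sup>\<perp> = \<gamma>(n) \<tau> - (\<xi> \<bullet> \<tau>) n\<close>, which is
  \<open>Z\<^sub>k(n) \<tau>\<close> since \<open>n \<bullet> \<tau> = 0\<close>. The rotation is a linear isomorphism, so it commutes with the
  arclength derivative and preserves its existence.\<close>

lemma perp_component: "perp p $ 1 = p $ 2" "perp p $ 2 = - p $ 1"
  by (simp_all add: perp_def)

lemma perp_perp: "perp (perp p) = - p"
  by (simp add: vec_eq_iff forall_2 perp_component)

lemma perp_minus: "perp (- p) = - perp p"
  by (simp add: vec_eq_iff forall_2 perp_component)

lemma inner_perp_self: "p \<bullet> perp p = 0"
  by (simp add: inner_vec_def sum_2 perp_component)

lemma norm_perp: "norm (perp p) = norm p"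
  by (simp add: norm_eq_sqrt_inner inner_vec_def sum_2 perp_component add.commute)

lemma bounded_linear_perp: "bounded_linear perp"
  by (intro linear_conv_bounded_linear[THEN iffD1] linearI)
    (simp_all add: vec_eq_iff forall_2 perp_component)

text \<open>This is \<open>perp\<close> applied to the expansion of \<open>x\<close> in the
  orthonormal basis \<open>n\<close>, \<open>perp n\<close>; the minus sign comes from
  \<open>perp (perp n) = - n\<close>.\<close>

lemma perp_unit_frame:
  assumes "norm n = 1"
  shows "perp x = (x \<bullet> n) *\<^sub>R perp n - (x \<bullet> perp n) *\<^sub>R n"
proof -
  have "n $ 1 * n $ 1 + n $ 2 * n $ 2 = 1"
    using assms by (simp add: norm_eq_1 inner_vec_def sum_2)
  then show ?thesis
    unfolding vec_eq_iff forall_2 inner_vec_def sum_2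
    by (simp add: perp_component) algebra
qed

lemma has_vector_derivative_perp_iff:
  "((\<lambda>x. perp (f x)) has_vector_derivative perp D) F \<longleftrightarrow> (f has_vector_derivative D) F"
proof
  assume "((\<lambda>x. perp (f x)) has_vector_derivative perp D) F"
  \<comment> \<open>The inverse of \<open>perp\<close> is \<open>- perp\<close>, itself bounded
    linear, so applying it recovers \<open>f\<close> and \<open>D\<close>.\<close>
  then have "((\<lambda>x. - perp (perp (f x))) has_vector_derivative - perp (perp D)) F"
    by (rule has_vector_derivative_minus[OF bounded_linear.has_vector_derivative[OF bounded_linear_perp]])
  then show "(f has_vector_derivative D) F"
    by (simp add: perp_perp)
next
  assume "(f has_vector_derivative D) F"
  then show "((\<lambda>x. perp (f x)) has_vector_derivative perp D) F"
    by (rule bounded_linear.has_vector_derivative[OF bounded_linear_perp])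
qed

text \<open>Every vector \<open>E\<close> equals \<open>perp (- perp E)\<close>, so any derivative
  of the rotated function has the form required by the preceding equivalence.\<close>

lemma differentiable_perp_iff:
  fixes f :: "real \<Rightarrow> real^2"
  shows "(\<lambda>x. perp (f x)) differentiable at s \<longleftrightarrow> f differentiable at s"
  by (metis has_vector_derivative_perp_iff perp_perp perp_minus minus_minus
      vector_derivative_works differentiableI_vector)

lemma vector_derivative_perp:
  fixes f :: "real \<Rightarrow> real^2"
  assumes "f differentiable at s"
  shows "vector_derivative (\<lambda>x. perp (f x)) (at s) = perp (vector_derivative f (at s))"
  using assms
  by (simp add: vector_derivative_at has_vector_derivative_perp_iff flip: vector_derivative_works)

lemma GDERIV_unique: "GDERIV f x :> D \<Longrightarrow> GDERIV f x :> E \<Longrightarrow> D = E"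
  unfolding gderiv_def
  by (metis (no_types, lifting) has_derivative_unique inner_commute vector_eq_rdot)

text \<open>Riesz representation: the gradient is the adjoint of the derivative, applied to
  1.\<close>

lemma differentiable_imp_GDERIV:
  fixes f :: "'a::euclidean_space \<Rightarrow> real"
  assumes "f differentiable at x"
  obtains D where "GDERIV f x :> D"
proof -
  obtain f' where f': "(f has_derivative f') (at x)"
    using assms by (auto simp: differentiable_def)
  then have "linear f'"
    by (rule has_derivative_linear)
  then have "f' h = h \<bullet> adjoint f' 1" for h
    using adjoint_works[of f' h 1] by simp
  then show ?thesis
    using f' that by (metis (no_types, lifting) ext gderiv_def)
qed

text \<open>Existence and uniqueness of the gradient justify the definite description in
  \<open>cahn_hoffman\<close>.\<close>

lemma GDERIV_cahn_hoffman:
  assumes "hom_ext \<gamma> differentiable at n"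
  shows "GDERIV (hom_ext \<gamma>) n :> cahn_hoffman \<gamma> n"
  unfolding cahn_hoffman_def
  by (rule differentiable_imp_GDERIV[OF assms], rule theI) (auto intro: GDERIV_unique)

lemma hom_ext_scaleR:
  assumes "norm n = 1" "c > 0"
  shows "hom_ext \<gamma> (c *\<^sub>R n) = c * \<gamma> n"
  using assms by (auto simp: hom_ext_def)

text \<open>Euler's identity: the extension is differentiated along the ray through \<open>n\<close>
  at parameter 1, once by the chain rule and once as a linear function of the parameter.\<close>

lemma cahn_hoffman_inner_self:
  assumes "hom_ext \<gamma> differentiable at n" and n: "norm n = 1"
  shows "cahn_hoffman \<gamma> n \<bullet> n = \<gamma> n"
proof -
  let ?\<xi> = "cahn_hoffman \<gamma> n"
  have "(hom_ext \<gamma> has_derivative (\<lambda>h. h \<bullet> ?\<xi>)) (at (1 *\<^sub>R n))"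
    using GDERIV_cahn_hoffman[OF assms(1)] by (simp add: gderiv_def)
  moreover have "((\<lambda>c. c *\<^sub>R n) has_derivative (\<lambda>h. h *\<^sub>R n)) (at (1::real))"
    by (auto intro!: derivative_eq_intros)
  ultimately have "((\<lambda>c. hom_ext \<gamma> (c *\<^sub>R n)) has_derivative (\<lambda>h. (h *\<^sub>R n) \<bullet> ?\<xi>)) (at (1::real))"
    by (rule has_derivative_compose[rotated])
  \<comment> \<open>Homogeneity covers positive factors only, so the two functions are exchanged on
    the open half-line, which contains 1.\<close>
  then have "((\<lambda>c. c * \<gamma> n) has_derivative (\<lambda>h. (h *\<^sub>R n) \<bullet> ?\<xi>)) (at (1::real))"
    by (rule has_derivative_transform_within_open[where s = "{0<..}"])
      (auto simp: hom_ext_scaleR[OF n])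
  moreover have "((\<lambda>c. c * \<gamma> n) has_derivative (\<lambda>h. h * \<gamma> n)) (at (1::real))"
    by (auto intro!: derivative_eq_intros)
  ultimately have "(\<lambda>h. (h *\<^sub>R n) \<bullet> ?\<xi>) = (\<lambda>h. h * \<gamma> n)"
    by (rule has_derivative_unique)
  from fun_cong[OF this, of 1] show ?thesis
    by (simp add: inner_commute)
qed

lemma outer_prod_mult_vec: "outer_prod u v *v x = (v \<bullet> x) *\<^sub>R u"
  by (simp add: outer_prod_def vec_eq_iff matrix_vector_mult_def matrix_matrix_mult_def
      columnvector_def transpose_def inner_vec_def sum_distrib_left mult_ac)

lemma Z_matrix_mult_perp:
  assumes "hom_ext \<gamma> differentiable at n" and n: "norm n = 1"
  shows "Z_matrix \<gamma> k n *v perp n = perp (cahn_hoffman \<gamma> n)"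
proof -
  have "Z_matrix \<gamma> k n *v perp n = \<gamma> n *\<^sub>R perp n - (cahn_hoffman \<gamma> n \<bullet> perp n) *\<^sub>R n"
    by (simp add: Z_matrix_def matrix_vector_mult_diff_rdistrib matrix_vector_mult_add_rdistrib
        scaleR_matrix_vector_assoc[symmetric] outer_prod_mult_vec inner_perp_self)
  \<comment> \<open>Euler's identity turns the coefficient \<open>\<gamma> n\<close> into the
    component of the Cahn-Hoffman vector along \<open>n\<close>.\<close>
  also have "\<dots> = perp (cahn_hoffman \<gamma> n)"
    using perp_unit_frame[OF n, of "cahn_hoffman \<gamma> n"] cahn_hoffman_inner_self[OF assms] by simp
  finally show ?thesis .
qed

theorem lemma2p1:
  fixes \<gamma> k :: "real^2 \<Rightarrow> real"
    and I :: "real set"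
    and L :: "real \<Rightarrow> real"
    and X :: "real \<Rightarrow> real \<Rightarrow> real^2"
    and \<mu> :: "real \<Rightarrow> real \<Rightarrow> real"
  assumes "surface_energy \<gamma>"
    and "\<forall>n\<in>sphere 0 1. k n > 0"
    and "is_interval I" and "interior I \<noteq> {}"
    and "evolving_closed_curve I L X"
    and "\<forall>t\<in>I. \<forall>s. \<mu> (s + L t) t = \<mu> s t"
  shows "asd_system \<gamma> I X \<mu> \<longleftrightarrow> asd_system_Z \<gamma> k I X \<mu>"
proof -
  let ?\<xi> = "\<lambda>\<sigma> \<theta>. cahn_hoffman \<gamma> (normal X \<sigma> \<theta>)"
  let ?Z = "\<lambda>\<sigma> \<theta>. Z_matrix \<gamma> k (normal X \<sigma> \<theta>) *v ds X \<sigma> \<theta>"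
  \<comment> \<open>At a fixed time this holds for all \<sigma>, so it may be differentiated in
    arclength.\<close>
  have Z_eq: "?Z \<sigma> t = perp (?\<xi> \<sigma> t)" if "t \<in> I" for \<sigma> t
  proof -
    have n: "norm (normal X \<sigma> t) = 1"
      using assms(5) that by (simp add: evolving_closed_curve_def normal_def norm_perp)
    \<comment> \<open>A unit vector is nonzero, hence avoids the origin, where smoothness is not
      assumed.\<close>
    then have "hom_ext \<gamma> differentiable at (normal X \<sigma> t)"
      using assms(1) unfolding surface_energy_def by (metis norm_zero zero_neq_one)
    moreover have "ds X \<sigma> t = perp (normal X \<sigma> t)"
      by (simp add: normal_def perp_minus perp_perp)
    ultimately show ?thesis
      using Z_matrix_mult_perp n by simp
  qed
  have "ds_exists ?Z s t \<longleftrightarrow> ds_exists ?\<xi> s t" if "t \<in> I" for s t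
    by (simp add: ds_exists_def Z_eq[OF that] differentiable_perp_iff)
  \<comment> \<open>Differentiability is required because \<open>ds\<close> has no controlled value
    elsewhere; both systems supply it through the preceding equivalence.\<close>
  moreover have "ds ?Z s t = perp (ds ?\<xi> s t)" if "t \<in> I" "ds_exists ?\<xi> s t" for s t
    using vector_derivative_perp[of "\<lambda>\<sigma>. ?\<xi> \<sigma> t" s] that(2)
    by (simp add: ds_def[of ?Z] ds_def[of ?\<xi>] ds_exists_def Z_eq[OF that(1)])
  ultimately show ?thesis
    unfolding asd_system_def asd_system_Z_def by (metis (no_types, lifting))
qed

end
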